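(* There exists a homeomorphism $f:[-1,1]^2\to[-1,1]^2$ with topological entropy $h_{top}(f)=0$ which is $(\omega,\alpha,\infty)$-sensitive, i.e. for every integer $n\ge 2$, $f$ is both $(\omega,n)$-sensitive and $(\alpha,n)$-sensitive.
   Context: $[-1,1]^2$ carries the Euclidean metric $d$. For sets $A,B$, $d(A,B)=\inf\{d(a,b):a\in A,b\in B\}$. For a homeomorphism $f$ of a compact metric space $X$ and $x\in X$, $\omega(x,f)$ is the set of points $y$ such that $f^{n_i}(x)\to y$ for some sequence of positive integers $n_1<n_2<\cdots$, and $\alpha(x,f)=\omega(x,f^{-1})$. For $n\ge 2$, $f$ is $(\omega,n)$-sensitive if there exists $s>0$ such that for every $x\in X$ and every neighborhood $U$ of $x$ there exist points $y_1,\dots,y_n\in U$ with $d(\omega(y_i,f),\omega(y_j,f))>s$ for all $i\ne j$; $f$ is $(\alpha,n)$-sensitive if $f^{-1}$ is $(\omega,n)$-sensitive. *)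

theory Defs
  imports "HOL-Analysis.Analysis"
begin

definition square :: "(real \<times> real) set" where
  "square = {-1..1} \<times> {-1..1}"

definition omega_limit :: "('a::metric_space \<Rightarrow> 'a) \<Rightarrow> 'a \<Rightarrow> 'a set" where
  "omega_limit f x = {y. \<exists>r::nat \<Rightarrow> nat. strict_mono r \<and> (\<forall>i. 0 < r i) \<and>
      (\<lambda>i. (f ^^ (r i)) x) \<longlonglongrightarrow> y}"

definition omega_n_sensitive :: "'a::metric_space set \<Rightarrow> ('a \<Rightarrow> 'a) \<Rightarrow> nat \<Rightarrow> bool" where
  "omega_n_sensitive X f n \<longleftrightarrow>
     (\<exists>s>0. \<forall>x\<in>X. \<forall>U. openin (top_of_set X) U \<and> x \<in> U \<longrightarrow>
        (\<exists>y::nat \<Rightarrow> 'a. (\<forall>i<n. y i \<in> U) \<and>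
           (\<forall>i<n. \<forall>j<n. i \<noteq> j \<longrightarrow> setdist (omega_limit f (y i)) (omega_limit f (y j)) > s)))"

text \<open>(alpha,n)-sensitivity: the inverse g is (omega,n)-sensitive.\<close>
definition alpha_n_sensitive ::
  "'a::metric_space set \<Rightarrow> ('a \<Rightarrow> 'a) \<Rightarrow> ('a \<Rightarrow> 'a) \<Rightarrow> nat \<Rightarrow> bool" where
  "alpha_n_sensitive X f g n \<longleftrightarrow> omega_n_sensitive X g n"

definition bowen_dist :: "('a::metric_space \<Rightarrow> 'a) \<Rightarrow> nat \<Rightarrow> 'a \<Rightarrow> 'a \<Rightarrow> real" where
  "bowen_dist f n x y = Max {dist ((f ^^ k) x) ((f ^^ k) y) | k. k < n}"

definition separated_set ::
  "'a::metric_space set \<Rightarrow> ('a \<Rightarrow> 'a) \<Rightarrow> nat \<Rightarrow> real \<Rightarrow> 'a set \<Rightarrow> bool" where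
  "separated_set X f n \<epsilon> E \<longleftrightarrow> E \<subseteq> X \<and>
     (\<forall>x\<in>E. \<forall>y\<in>E. x \<noteq> y \<longrightarrow> bowen_dist f n x y > \<epsilon>)"

text \<open>Maximal cardinality of a finite (n,eps)-separated set (finite and bounded for compact X).\<close>
definition sep_num :: "'a::metric_space set \<Rightarrow> ('a \<Rightarrow> 'a) \<Rightarrow> nat \<Rightarrow> real \<Rightarrow> nat" where
  "sep_num X f n \<epsilon> = Sup {card E | E. finite E \<and> separated_set X f n \<epsilon> E}"

definition top_entropy :: "'a::metric_space set \<Rightarrow> ('a \<Rightarrow> 'a) \<Rightarrow> ereal" where
  "top_entropy X f =
     (SUP \<epsilon>\<in>{0<..}. limsup (\<lambda>n. ereal (ln (real (sep_num X f n \<epsilon>)) / real n)))"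

end

theory Submission
  imports Defs
begin

text \<open>
  In coordinates \<open>x = tanh t\<close>, \<open>y = tanh u\<close> the homeomorphism is \<open>(t, u) \<mapsto> (t + 1, u + \<delta> (t + 1/2))\<close>
  with an even function \<open>\<delta>\<close> vanishing at infinity; evenness makes it conjugate to its inverse by
  \<open>p \<mapsto> -p\<close>. On \<open>2\<^sup>j \<le> t < 2\<^sup>j\<^sup>+\<^sup>1\<close> we take \<open>\<delta> t = sin (2 \<pi> 5\<^sup>j t) / 2\<^sup>j\<close>, so the total drift of an orbit is
  essentially the lacunary series \<open>\<Sum>\<^sub>j sin (2 \<pi> 5\<^sup>j t)\<close>. On a dense set of \<open>t\<close> this series is finite, and
  locally its values come close to every element of a translate of the integers. Hence every open
  set contains orbits converging to points \<open>(1, tanh v)\<close> with \<open>v\<close> near \<open>0, 4, 8, \<dots>\<close>, uniformly in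
  the open set. The frequency \<open>5\<^sup>j\<close> is polynomial in the time \<open>2\<^sup>j\<close>, so \<open>n\<close> iterates stretch
  distances at most polynomially in \<open>n\<close> and the entropy vanishes.
\<close>

section \<open>Bounds for the hyperbolic tangent\<close>

lemma abs_tanh_less_1: "\<bar>tanh (x::real)\<bar> < 1"
  using tanh_real_lt_1[of x] tanh_real_gt_neg1[of x] by linarith

lemma abs_tanh_le: "\<bar>tanh (x::real)\<bar> \<le> \<bar>x\<bar>" and tanh_lipschitz: "\<bar>tanh x - tanh y\<bar> \<le> \<bar>x - y\<bar>"
proof -
  have L: "\<bar>tanh x - tanh y\<bar> \<le> \<bar>x - y\<bar>" for x y :: real
  proof -
    have "norm (tanh x - tanh y) \<le> 1 * norm (x - y)"
    proof (rule field_differentiable_bound[where S = UNIV])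
      fix z :: real
      show "(tanh has_field_derivative 1 - tanh z ^ 2) (at z within UNIV)"
        by (auto intro!: derivative_eq_intros)
      have "tanh z ^ 2 < 1"
        using abs_tanh_less_1[of z] by (simp add: abs_square_less_1)
      then show "norm (1 - tanh z ^ 2) \<le> 1" by simp
    qed auto
    then show ?thesis by simp
  qed
  show "\<bar>tanh x - tanh y\<bar> \<le> \<bar>x - y\<bar>" by (rule L)
  show "\<bar>tanh x\<bar> \<le> \<bar>x\<bar>" using L[of x 0] by simp
qed

lemma tanh_artanh: "\<bar>x::real\<bar> < 1 \<Longrightarrow> tanh (artanh x) = x"
  by (simp add: artanh_def tanh_real_altdef exp_minus field_simps)

section \<open>The drift\<close>

text \<open>A drift wave on the dyadic block \<open>[2\<^sup>j, 2\<^sup>j\<^sup>+\<^sup>1)\<close>: it has period \<open>1\<close>, so the drifts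
  collected along the \<open>2\<^sup>j\<close> integer translates of \<open>t\<close> in the block add up to \<open>sin (2 \<pi> 5\<^sup>j t)\<close>.\<close>

definition wave :: "nat \<Rightarrow> real \<Rightarrow> real" where
  "wave j t = sin (2 * pi * 5 ^ j * t) / 2 ^ j"

text \<open>Block 0 is widened to all of \<open>\<bar>t\<bar> < 2\<close>, so that every real number
  lies in some block.\<close>

definition level :: "real \<Rightarrow> nat" where
  "level t = (LEAST j. \<bar>t\<bar> < 2 ^ (j + 1))"

text \<open>The absolute value makes the drift even; this is what turns
  \<open>p \<mapsto> - p\<close> into a time reversal of the homeomorphism.\<close>

definition drift :: "real \<Rightarrow> real" where
  "drift t = wave (level t) \<bar>t\<bar>"

lemma sin_two_pi_add_int: "sin (2 * pi * (x + of_int k)) = sin (2 * pi * x)"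
proof -
  have "sin (2 * pi * (x + of_int k)) = sin (2 * pi * x + 2 * pi * of_int k)"
    by (simp add: algebra_simps)
  then show ?thesis by (simp add: sin_add sin_integer_2pi cos_integer_2pi)
qed

lemma wave_add_int: "wave j (t + of_int k) = wave j t"
  using sin_two_pi_add_int[of "5 ^ j * t" "5 ^ j * k"]
  by (simp add: wave_def algebra_simps)

lemma wave_int: "wave j (of_int k) = 0"
  using wave_add_int[of j 0 k] by (simp add: wave_def)

lemma abs_wave_le: "\<bar>wave j t\<bar> \<le> 1 / 2 ^ j"
  by (simp add: wave_def divide_right_mono)

lemma sin_lipschitz: "\<bar>sin x - sin (y::real)\<bar> \<le> \<bar>x - y\<bar>"
proof -
  have "\<bar>sin x - sin y\<bar> = 2 * \<bar>sin ((x - y) / 2)\<bar> * \<bar>cos ((x + y) / 2)\<bar>"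
    by (simp add: sin_diff_sin abs_mult)
  also have "\<dots> \<le> 2 * \<bar>(x - y) / 2\<bar> * 1"
    by (intro mult_mono abs_sin_x_le_abs_x) auto
  finally show ?thesis by simp
qed

lemma wave_lipschitz: "\<bar>wave j s - wave j t\<bar> \<le> 2 * pi * (5/2) ^ j * \<bar>s - t\<bar>"
proof -
  have "\<bar>wave j s - wave j t\<bar> = \<bar>sin (2 * pi * 5 ^ j * s) - sin (2 * pi * 5 ^ j * t)\<bar> / 2 ^ j"
    by (simp add: wave_def diff_divide_distrib[symmetric])
  also have "\<dots> \<le> \<bar>2 * pi * 5 ^ j * s - 2 * pi * 5 ^ j * t\<bar> / 2 ^ j"
    by (intro divide_right_mono sin_lipschitz) auto
  also have "\<dots> = 2 * pi * (5/2) ^ j * \<bar>s - t\<bar>"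
    by (simp add: abs_mult power_divide flip: right_diff_distrib)
  finally show ?thesis .
qed

lemma less_two_power_level: "\<bar>t\<bar> < 2 ^ (level t + 1)"
proof -
  obtain n where "\<bar>t\<bar> < 2 ^ n"
    using real_arch_pow[of 2 "\<bar>t\<bar>"] by auto
  then have "\<bar>t\<bar> < 2 ^ (n + 1)"
    by (rule less_le_trans) (rule power_increasing, auto)
  then show ?thesis
    unfolding level_def by (rule LeastI)
qed

lemma two_power_level_le: "level t \<noteq> 0 \<Longrightarrow> 2 ^ level t \<le> \<bar>t\<bar>"
  using not_less_Least[of "level t - 1" "\<lambda>j. \<bar>t\<bar> < 2 ^ (j + 1)"]
  unfolding level_def[symmetric] by simp

lemma level_mono: "\<bar>s\<bar> \<le> \<bar>t\<bar> \<Longrightarrow> level s \<le> level t"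
  using less_two_power_level[of t] unfolding level_def[of s] by (intro Least_le) linarith

lemma level_eq:
  assumes "2 ^ j \<le> \<bar>t\<bar>" "\<bar>t\<bar> < 2 ^ (j + 1)"
  shows "level t = j"
proof (rule antisym)
  show "level t \<le> j" using assms unfolding level_def by (intro Least_le)
  have "(2::real) ^ j < 2 ^ (level t + 1)"
    using assms(1) less_two_power_level[of t] by linarith
  then show "j \<le> level t" by (subst (asm) power_strict_increasing_iff) auto
qed

lemma drift_minus: "drift (- t) = drift t"
  by (simp add: drift_def level_def)

lemma abs_drift_le_1: "\<bar>drift t\<bar> \<le> 1"
proof -
  have "(1::real) / 2 ^ level t \<le> 1" by (simp add: divide_simps)
  then show ?thesis using abs_wave_le[of "level t" "\<bar>t\<bar>"] unfolding drift_def by linarith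
qed

text \<open>In block \<open>j\<close> the amplitude \<open>1 / 2 ^ j\<close> meets
  \<open>\<bar>t\<bar> < 2 ^ (j + 1)\<close>. This decay gives both continuity at the vertical edges
  of the square and control of long orbits far from the centre.\<close>

lemma abs_drift_mult_le: "\<bar>drift t\<bar> * \<bar>t\<bar> \<le> 2"
proof -
  have "\<bar>drift t\<bar> * \<bar>t\<bar> \<le> (1 / 2 ^ level t) * 2 ^ (level t + 1)"
    using less_two_power_level[of t] abs_wave_le[of "level t" "\<bar>t\<bar>"]
    unfolding drift_def by (intro mult_mono) auto
  then show ?thesis by simp
qed

lemma abs_drift_le: "0 < T \<Longrightarrow> T \<le> \<bar>t\<bar> \<Longrightarrow> \<bar>drift t\<bar> \<le> 2 / T"
  using abs_drift_mult_le[of t] mult_left_mono[of T "\<bar>t\<bar>" "\<bar>drift t\<bar>"]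
  by (simp add: pos_le_divide_eq)

text \<open>The slope in block \<open>j\<close> is of order
  \<open>(5/2) ^ j \<le> (2 ^ j)\<^sup>2\<close>, and blocks other than block 0 begin at
  \<open>2 ^ j\<close>. The constant is thus only quadratic in \<open>R\<close>, which keeps the
  separation of orbits polynomial in time.\<close>

lemma drift_lipschitz:
  assumes "\<bar>s\<bar> \<le> R" "\<bar>t\<bar> \<le> R"
  shows "\<bar>drift s - drift t\<bar> \<le> 8 * (1 + R\<^sup>2) * \<bar>s - t\<bar>"
proof -
  have main: "\<bar>drift s - drift t\<bar> \<le> 8 * (1 + R\<^sup>2) * \<bar>s - t\<bar>"
    if le: "\<bar>s\<bar> \<le> \<bar>t\<bar>" and R: "\<bar>t\<bar> \<le> R" for s t
  proof -
    define i j where "i = level s" and "j = level t"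
    have ij: "i \<le> j" unfolding i_def j_def by (rule level_mono) fact
    define L where "L = 2 * pi * (5/2::real) ^ j"
    have L0: "L \<ge> 0" by (simp add: L_def)
    have "(5/2::real) ^ j \<le> 4 ^ j" by (intro power_mono) auto
    also have "(4::real) ^ j = (2 ^ j)\<^sup>2" by (simp add: power_mult_distrib[symmetric] power2_eq_square)
    also have "(2 ^ j)\<^sup>2 \<le> 1 + R\<^sup>2"
    proof (cases "j = 0")
      case False
      then have "(2::real) ^ j \<le> R" using two_power_level_le[of t] R by (simp add: j_def)
      then have "((2::real) ^ j)\<^sup>2 \<le> R\<^sup>2" by (intro power_mono) auto
      then show ?thesis by simp
    qed simp
    finally have "L \<le> 8 * (1 + R\<^sup>2)"
      unfolding L_def using pi_less_4 by (intro mult_mono) auto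
    moreover have "\<bar>drift s - drift t\<bar> \<le> L * \<bar>\<bar>s\<bar> - \<bar>t\<bar>\<bar>"
    proof (cases "i = j")
      case True
      then show ?thesis
        using wave_lipschitz[of j "\<bar>s\<bar>" "\<bar>t\<bar>"] by (simp add: drift_def i_def j_def L_def)
    next
      case False
      \<comment> \<open>The block boundaries \<open>2 ^ (i + 1) \<le> 2 ^ j\<close> lie between
        \<open>\<bar>s\<bar>\<close> and \<open>\<bar>t\<bar>\<close>. Being integers, they are
        zeros of the waves, so each drift is compared with a zero of its own wave.\<close>
      then have "i + 1 \<le> j" using ij by simp
      then have le1: "(2::real) ^ (i + 1) \<le> 2 ^ j" by (intro power_increasing) auto
      have s: "\<bar>s\<bar> < 2 ^ (i + 1)" unfolding i_def by (rule less_two_power_level)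
      have t: "2 ^ j \<le> \<bar>t\<bar>" unfolding j_def by (rule two_power_level_le) (use False ij in \<open>simp add: j_def\<close>)
      have "\<bar>drift s\<bar> \<le> 2 * pi * (5/2) ^ i * (2 ^ (i + 1) - \<bar>s\<bar>)"
        using wave_lipschitz[of i "\<bar>s\<bar>" "2 ^ (i + 1)"] wave_int[of i "2 ^ (i + 1)"] s
        by (simp add: drift_def i_def[symmetric])
      also have "\<dots> \<le> L * (2 ^ (i + 1) - \<bar>s\<bar>)"
        unfolding L_def using s ij by (intro mult_right_mono mult_left_mono power_increasing) auto
      finally have "\<bar>drift s\<bar> \<le> L * (2 ^ (i + 1) - \<bar>s\<bar>)" .
      moreover have "\<bar>drift t\<bar> \<le> L * (\<bar>t\<bar> - 2 ^ j)"
        using wave_lipschitz[of j "\<bar>t\<bar>" "2 ^ j"] wave_int[of j "2 ^ j"] t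
        by (simp add: drift_def j_def[symmetric] L_def)
      ultimately have "\<bar>drift s - drift t\<bar> \<le> L * (2 ^ (i + 1) - \<bar>s\<bar>) + L * (\<bar>t\<bar> - 2 ^ j)" by linarith
      also have "\<dots> = L * ((2 ^ (i + 1) - \<bar>s\<bar>) + (\<bar>t\<bar> - 2 ^ j))" by (simp add: algebra_simps)
      also have "\<dots> \<le> L * (\<bar>\<bar>s\<bar> - \<bar>t\<bar>\<bar>)" using L0 le1 by (intro mult_left_mono) auto
      finally show ?thesis .
    qed
    moreover have "\<bar>\<bar>s\<bar> - \<bar>t\<bar>\<bar> \<le> \<bar>s - t\<bar>" by linarith
    ultimately show ?thesis
      by (meson L0 abs_ge_zero mult_mono order_trans)
  qed
  show ?thesis
    using main[of s t] main[of t s] assms by (cases "\<bar>s\<bar> \<le> \<bar>t\<bar>") (auto simp: abs_minus_commute)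
qed

lemma continuous_drift: "continuous_on UNIV drift"
proof (rule continuous_at_imp_continuous_on, intro ballI)
  fix t :: real
  define C where "C = 8 * (1 + (\<bar>t\<bar> + 1)\<^sup>2)"
  have "eventually (\<lambda>s. \<bar>s - t\<bar> < 1) (at t)"
    using eventually_at_ball[of 1 t UNIV] by (auto simp: dist_real_def abs_minus_commute elim: eventually_mono)
  then have "eventually (\<lambda>s. norm (drift s - drift t) \<le> C * \<bar>s - t\<bar>) (at t)"
    by eventually_elim (use drift_lipschitz[of _ "\<bar>t\<bar> + 1" t] in \<open>auto simp: C_def\<close>)
  moreover have "((\<lambda>s. C * \<bar>s - t\<bar>) \<longlongrightarrow> 0) (at t)"
    by (auto intro!: tendsto_eq_intros)
  ultimately have "((\<lambda>s. drift s - drift t) \<longlongrightarrow> 0) (at t)"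
    by (rule Lim_null_comparison)
  then show "isCont drift t"
    by (simp add: isCont_def LIM_zero_iff)
qed

section \<open>Prescribing the total drift\<close>

lemma sum_powers_5: "(\<Sum>j<m. (5::real) ^ j) = (5 ^ m - 1) / 4"
  by (simp add: geometric_sum)

text \<open>Since \<open>5 \<equiv> 1 (mod 4)\<close>, multiplication by \<open>5\<close> fixes \<open>\<plusminus>1/4\<close> modulo \<open>1\<close>; the truncation
  \<open>(1 - 5\<^sup>-\<^sup>q) / 4\<close> shadows this fixed point for \<open>q\<close> steps and then becomes an integer.\<close>

lemma sin_shadowing:
  fixes a \<sigma> :: int
  assumes t: "t = a / 5 ^ m + \<sigma> * (1 - 1 / 5 ^ q) / (4 * 5 ^ m)" and k: "k < q"
    and \<sigma>: "\<sigma> = 1 \<or> \<sigma> = -1"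
  shows "\<bar>sin (2 * pi * 5 ^ (m + k) * t) - \<sigma>\<bar> \<le> 2 * (1/25) ^ (q - k)"
proof -
  obtain d :: int where "5 ^ k - 1 = 4 * d"
    using power_diff_1_eq[of "5::int" k] by auto
  then have "real_of_int (5 ^ k - 1) = real_of_int (4 * d)" by (rule arg_cong)
  then have d: "(5::real) ^ k = 4 * d + 1" by simp
  define r where "r = q - k"
  have q: "q = k + r" using k by (simp add: r_def)
  define x where "x = 1 / (4 * 5 ^ r :: real)"
  \<comment> \<open>Because 4 divides \<open>5 ^ k - 1\<close>, the phase is
    \<open>\<sigma> * (1/4 - x)\<close> modulo 1, a signed quarter turn up to the error
    \<open>x\<close>.\<close>
  have "5 ^ (m + k) * t = 5 ^ k * a + \<sigma> * (5 ^ k - 1 / 5 ^ r) / 4"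
    unfolding t q by (simp add: field_simps power_add)
  also have "\<dots> = \<sigma> * (1/4 - x) + of_int (5 ^ k * a + \<sigma> * d)"
    by (simp add: x_def d field_simps)
  finally have "sin (2 * pi * (5 ^ (m + k) * t)) = sin (2 * pi * (\<sigma> * (1/4 - x)))"
    by (simp only: sin_two_pi_add_int)
  also have "\<dots> = \<sigma> * sin (pi / 2 - 2 * pi * x)"
    using \<sigma> by (auto simp: algebra_simps sin_diff)
  finally have eq: "sin (2 * pi * 5 ^ (m + k) * t) = \<sigma> * cos (2 * pi * x)"
    by (simp add: cos_sin_eq mult.assoc)
  have "\<sigma> * cos (2 * pi * x) - \<sigma> = - \<sigma> * (1 - cos (2 * pi * x))"
    by (simp add: algebra_simps)
  then have "\<bar>\<sigma> * cos (2 * pi * x) - \<sigma>\<bar> = 1 - cos (2 * pi * x)"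
    using \<sigma> by (auto simp: abs_mult)
  \<comment> \<open>Near an extremum of the sine the error is quadratic in \<open>x\<close>, hence
    of order \<open>(1/25) ^ r\<close>.\<close>
  also have "\<dots> = 2 * \<bar>sin (pi * x)\<bar>\<^sup>2"
    using cos_double_sin[of "pi * x"] by (simp add: mult.assoc)
  also have "\<dots> \<le> 2 * \<bar>pi * x\<bar>\<^sup>2"
    by (intro mult_left_mono power_mono abs_sin_x_le_abs_x) auto
  also have "\<dots> \<le> 2 * (4 * x)\<^sup>2"
    using pi_less_4 by (intro mult_left_mono power_mono) (auto simp: x_def abs_mult field_simps)
  also have "(4 * x)\<^sup>2 = (1/25) ^ r"
    by (simp add: x_def power_divide power2_eq_square flip: power_mult_distrib)
  finally show ?thesis by (simp add: eq r_def)
qed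

text \<open>As 4 divides \<open>5 ^ q - 1\<close>, the number \<open>5 ^ (m + q) * t\<close> is an
  integer. From then on all sines vanish, which makes the total drift a finite sum.\<close>

lemma sin_after_shadowing:
  fixes a \<sigma> :: int
  assumes t: "t = a / 5 ^ m + \<sigma> * (1 - 1 / 5 ^ q) / (4 * 5 ^ m)" and k: "q + m \<le> j"
  shows "sin (2 * pi * 5 ^ j * t) = 0"
proof -
  define r where "r = j - (q + m)"
  have j: "j = q + m + r" using k by (simp add: r_def)
  obtain d :: int where "5 ^ q - 1 = 4 * d"
    using power_diff_1_eq[of "5::int" q] by auto
  then have "real_of_int (5 ^ q - 1) = real_of_int (4 * d)" by (rule arg_cong)
  then have d: "(5::real) ^ q = 4 * d + 1" by simp
  have "5 ^ j * t = 5 ^ r * (5 ^ q * a + \<sigma> * (5 ^ q - 1) / 4)"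
    unfolding t j by (simp add: field_simps power_add)
  also have "\<dots> = of_int (5 ^ r * (5 ^ q * a + \<sigma> * d))"
    by (simp add: d field_simps)
  finally show ?thesis
    using sin_two_pi_add_int[of 0 "5 ^ r * (5 ^ q * a + \<sigma> * d)"] by (simp only: mult.assoc) simp
qed

text \<open>A point \<open>a / 5 ^ m\<close> near \<open>c\<close> is perturbed at scale
  \<open>1 / 5 ^ m\<close>. Frequencies below \<open>5 ^ m\<close> hardly notice and contribute
  about \<open>P\<close>, the next \<open>\<bar>k\<bar>\<close> contribute about the sign of
  \<open>k\<close> each, and the later ones vanish. Hence \<open>P\<close> can be fixed before
  \<open>k\<close>.\<close>

lemma sin_sums_hit:
  fixes c \<rho> :: real and l :: nat
  assumes "0 < \<rho>"
  obtains P :: real where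
    "\<And>k::int. \<exists>t. \<bar>t - c\<bar> < \<rho> \<and> (\<exists>J\<ge>l. (\<forall>j\<ge>J. sin (2 * pi * 5 ^ j * t) = 0) \<and>
       \<bar>(\<Sum>j=l..<J. sin (2 * pi * 5 ^ j * t)) - P - k\<bar> \<le> 3/4)"
proof -
  \<comment> \<open>Half of \<open>\<rho>\<close> pays for rounding \<open>c\<close> to
    \<open>t0\<close>, the other half for the perturbation from \<open>t0\<close> to
    \<open>t\<close>.\<close>
  obtain m0 where m0: "(1/5) ^ m0 < \<rho> / 2"
    using real_arch_pow_inv[of "\<rho> / 2" "1/5"] assms by auto
  define m where "m = max m0 l"
  have "(1/5::real) ^ m \<le> (1/5) ^ m0" by (intro power_decreasing) (auto simp: m_def)
  then have m: "1 / 5 ^ m < \<rho> / 2" using m0 by (simp add: power_divide)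
  have lm: "l \<le> m" by (simp add: m_def)
  define a where "a = \<lfloor>5 ^ m * c\<rfloor>"
  define t0 where "t0 = a / 5 ^ m"
  have "\<bar>a - 5 ^ m * c\<bar> \<le> 1" unfolding a_def by linarith
  then have "\<bar>a - 5 ^ m * c\<bar> / 5 ^ m \<le> 1 / 5 ^ m" by (intro divide_right_mono) auto
  then have "\<bar>(a - 5 ^ m * c) / 5 ^ m\<bar> \<le> 1 / 5 ^ m" by simp
  then have t0: "\<bar>t0 - c\<bar> \<le> 1 / 5 ^ m" by (simp add: t0_def diff_divide_distrib)
  define P where "P = (\<Sum>j=l..<m. sin (2 * pi * 5 ^ j * t0))"
  show ?thesis
  proof (rule that[of P])
    fix k :: int
    define \<sigma> :: int where "\<sigma> = (if k \<ge> 0 then 1 else -1)"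
    define q where "q = nat \<bar>k\<bar>"
    have k: "real_of_int k = \<sigma> * real q" by (simp add: \<sigma>_def q_def)
    have \<sigma>: "\<sigma> = 1 \<or> \<sigma> = -1" by (simp add: \<sigma>_def)
    define t where "t = a / 5 ^ m + \<sigma> * (1 - 1 / 5 ^ q) / (4 * 5 ^ m)"
    have "\<bar>t - t0\<bar> = (1 - 1 / 5 ^ q) / (4 * 5 ^ m)"
      using \<sigma> by (auto simp: t_def t0_def abs_mult)
    also have "\<dots> \<le> 1 / (4 * 5 ^ m)" by (intro divide_right_mono) auto
    finally have tt0: "\<bar>t - t0\<bar> \<le> 1 / (4 * 5 ^ m)" .
    also have "\<dots> \<le> 1 / 5 ^ m" by (intro divide_left_mono) auto
    finally have close: "\<bar>t - c\<bar> < \<rho>" using t0 m by linarith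
    \<comment> \<open>The perturbation is at most a quarter of \<open>1 / 5 ^ m\<close>, so the
      geometric sum of the lower frequencies bounds the change by \<open>pi / 8\<close>.\<close>
    have "\<bar>(\<Sum>j=l..<m. sin (2 * pi * 5 ^ j * t)) - P\<bar>
        \<le> (\<Sum>j=l..<m. \<bar>sin (2 * pi * 5 ^ j * t) - sin (2 * pi * 5 ^ j * t0)\<bar>)"
      unfolding P_def sum_subtractf[symmetric] by (rule sum_abs)
    also have "\<dots> \<le> (\<Sum>j=l..<m. 2 * pi / (4 * 5 ^ m) * 5 ^ j)"
    proof (rule sum_mono)
      fix j
      have "\<bar>sin (2 * pi * 5 ^ j * t) - sin (2 * pi * 5 ^ j * t0)\<bar>
          \<le> \<bar>2 * pi * 5 ^ j * t - 2 * pi * 5 ^ j * t0\<bar>" by (rule sin_lipschitz)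
      also have "\<dots> = 2 * pi * 5 ^ j * \<bar>t - t0\<bar>"
        by (simp add: abs_mult flip: right_diff_distrib)
      also have "\<dots> \<le> 2 * pi * 5 ^ j * (1 / (4 * 5 ^ m))"
        using tt0 by (intro mult_left_mono) auto
      finally show "\<bar>sin (2 * pi * 5 ^ j * t) - sin (2 * pi * 5 ^ j * t0)\<bar>
          \<le> 2 * pi / (4 * 5 ^ m) * 5 ^ j" by simp
    qed
    also have "\<dots> \<le> (\<Sum>j<m. 2 * pi / (4 * 5 ^ m) * 5 ^ j)"
      by (intro sum_mono2) auto
    also have "\<dots> = 2 * pi / (4 * 5 ^ m) * ((5 ^ m - 1) / 4)"
      by (simp only: sum_distrib_left[symmetric] sum_powers_5)
    also have "\<dots> \<le> 2 * pi / (4 * 5 ^ m) * (5 ^ m / 4)"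
      by (intro mult_left_mono divide_right_mono) auto
    also have "\<dots> \<le> 1/2" using pi_less_4 by simp
    finally have low: "\<bar>(\<Sum>j=l..<m. sin (2 * pi * 5 ^ j * t)) - P\<bar> \<le> 1/2" .
    have "\<bar>(\<Sum>k<q. sin (2 * pi * 5 ^ (m + k) * t)) - \<sigma> * real q\<bar>
        = \<bar>\<Sum>k<q. sin (2 * pi * 5 ^ (m + k) * t) - \<sigma>\<bar>"
      by (simp add: sum_subtractf mult.commute)
    also have "\<dots> \<le> (\<Sum>k<q. \<bar>sin (2 * pi * 5 ^ (m + k) * t) - \<sigma>\<bar>)" by (rule sum_abs)
    also have "\<dots> \<le> (\<Sum>k<q. 2 * (1/25) ^ (q - k))"
      by (intro sum_mono sin_shadowing[OF t_def _ \<sigma>]) simp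
    also have "\<dots> = (\<Sum>k<q. 2/25 * (1/25) ^ (q - Suc k))"
      by (intro sum.cong refl) (simp add: Suc_diff_Suc[symmetric])
    also have "\<dots> = (\<Sum>k<q. 2/25 * (1/25) ^ k)"
      by (rule sum.nat_diff_reindex)
    also have "\<dots> = 2/25 * ((1 - (1/25) ^ q) / (24/25))"
      unfolding sum_distrib_left[symmetric] by (subst geometric_sum) (auto simp: field_simps)
    also have "\<dots> \<le> 2/25 * (1 / (24/25))"
      by (intro mult_left_mono divide_right_mono) auto
    finally have high: "\<bar>(\<Sum>k<q. sin (2 * pi * 5 ^ (m + k) * t)) - \<sigma> * real q\<bar> \<le> 1/4"
      by simp
    have "(\<Sum>j=l..<m + q. sin (2 * pi * 5 ^ j * t))
        = (\<Sum>j=l..<m. sin (2 * pi * 5 ^ j * t)) + (\<Sum>j=m..<m + q. sin (2 * pi * 5 ^ j * t))"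
      using lm by (simp add: sum.atLeastLessThan_concat)
    also have "(\<Sum>j=m..<m + q. sin (2 * pi * 5 ^ j * t)) = (\<Sum>k<q. sin (2 * pi * 5 ^ (m + k) * t))"
      using sum.shift_bounds_nat_ivl[of "\<lambda>j. sin (2 * pi * 5 ^ j * t)" 0 m q]
      by (simp add: add.commute lessThan_atLeast0)
    finally have "\<bar>(\<Sum>j=l..<m + q. sin (2 * pi * 5 ^ j * t)) - P - k\<bar> \<le> 3/4"
      using low high k by linarith
    moreover have "\<forall>j\<ge>m + q. sin (2 * pi * 5 ^ j * t) = 0"
      using sin_after_shadowing[OF t_def] by (simp add: add.commute)
    ultimately show "\<exists>t. \<bar>t - c\<bar> < \<rho> \<and> (\<exists>J\<ge>l. (\<forall>j\<ge>J. sin (2 * pi * 5 ^ j * t) = 0) \<and>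
       \<bar>(\<Sum>j=l..<J. sin (2 * pi * 5 ^ j * t)) - P - k\<bar> \<le> 3/4)"
      using close lm by (intro exI[of _ t] conjI exI[of _ "m + q"]) auto
  qed
qed

text \<open>Block boundaries are integers, so the integer part \<open>z + int i\<close> alone
  decides the block of \<open>t + real i\<close>; the period 1 of the wave then removes
  \<open>i\<close>.\<close>

lemma drift_translate:
  assumes "of_int z \<le> t" "t < of_int z + 1" "2 ^ j \<le> z + int i" "z + int i < 2 ^ (j + 1)"
  shows "drift (t + real i) = wave j t"
proof -
  have "real_of_int (2 ^ j) \<le> real_of_int (z + int i)" using assms(3) by (simp only: of_int_le_iff)
  then have lo: "2 ^ j \<le> t + real i" using assms(1) by simp
  have "z + int i + 1 \<le> 2 ^ (j + 1)" using assms(4) by simp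
  then have "real_of_int (z + int i + 1) \<le> real_of_int (2 ^ (j + 1))" by (simp only: of_int_le_iff)
  then have hi: "t + real i < 2 ^ (j + 1)" using assms(2) by simp
  have pos: "0 \<le> t + real i" using lo by (rule order_trans[rotated]) simp
  have "level (t + real i) = j" using lo hi pos by (intro level_eq) auto
  then show ?thesis using pos wave_add_int[of j t "int i"] by (simp add: drift_def)
qed

text \<open>The orbit of \<open>t\<close> enters block \<open>N\<close> at step
  \<open>2 ^ N - z\<close> and spends \<open>2 ^ N\<close> steps there, each adding the same
  \<open>wave N t\<close>. The steps before block \<open>l\<close>, where \<open>t\<close> may be
  negative, stay as an initial sum.\<close>

lemma sum_drift_blocks:
  fixes z :: int
  assumes z: "of_int z \<le> t" "t < of_int z + 1" and l: "z \<le> 2 ^ l" and "l \<le> N"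
  shows "(\<Sum>i<nat (2 ^ N - z). drift (t + real i)) =
    (\<Sum>i<nat (2 ^ l - z). drift (t + real i)) + (\<Sum>j=l..<N. sin (2 * pi * 5 ^ j * t))"
  using \<open>l \<le> N\<close>
proof (induction N rule: dec_induct)
  case (step N)
  have "(2::int) ^ l \<le> 2 ^ N" using step.hyps by (intro power_increasing) auto
  then have zN: "z \<le> 2 ^ N" using l by linarith
  define K where "K = nat (2 ^ N - z)"
  have K: "nat (2 ^ Suc N - z) = K + 2 ^ N"
    using zN order_trans[OF zN, of "2 * 2 ^ N"] by (auto simp: K_def nat_eq_iff)
  have "(\<Sum>i<K + 2 ^ N. drift (t + real i))
      = (\<Sum>i<K. drift (t + real i)) + (\<Sum>i=K..<K + 2 ^ N. drift (t + real i))"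
    unfolding lessThan_atLeast0 by (simp add: sum.atLeastLessThan_concat)
  also have "(\<Sum>i=K..<K + 2 ^ N. drift (t + real i)) = (\<Sum>i=K..<K + 2 ^ N. wave N t)"
  proof (rule sum.cong)
    fix i assume "i \<in> {K..<K + 2 ^ N}"
    then have "int K \<le> int i" "int i < int (K + 2 ^ N)" by (simp_all only: of_nat_le_iff of_nat_less_iff atLeastLessThan_iff)
    then show "drift (t + real i) = wave N t"
      using z zN by (intro drift_translate[of z]) (auto simp: K_def)
  qed simp
  also have "\<dots> = sin (2 * pi * 5 ^ N * t)" by (simp add: wave_def)
  finally show ?case using step unfolding K by (simp add: K_def)
qed simp

text \<open>The initial sum \<open>Q\<close> over the steps before block \<open>l\<close> is
  continuous, so it is constant up to \<open>1/4\<close> near a suitable point. The sine sum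
  supplies the integers with error \<open>3/4\<close>, and the errors add up to 1.\<close>

lemma displacements_hit:
  fixes t \<rho> :: real
  assumes "0 < \<rho>"
  obtains P :: real where
    "\<And>k::int. \<exists>t' s. \<bar>t' - t\<bar> < \<rho> \<and> \<bar>s - P - k\<bar> \<le> 1 \<and>
       (\<forall>\<^sub>F n in sequentially. (\<Sum>i<n. drift (t' + real i)) = s)"
proof -
  define z where "z = \<lfloor>t\<rfloor>"
  \<comment> \<open>Moving off \<open>t\<close> into the interior of a unit interval lets all points
    near \<open>t1\<close> share the integer part \<open>z\<close>, even if \<open>t\<close> is an
    integer.\<close>
  obtain t1 where t1: "t < t1" "t1 < min (t + \<rho>) (z + 1)"
    using dense[of t "min (t + \<rho>) (z + 1)"] assms by (auto simp: z_def)
  obtain l where "real_of_int z < 2 ^ l"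
    using real_arch_pow[of 2 "real_of_int z"] by auto
  then have "real_of_int z < real_of_int (2 ^ l)" by simp
  then have l: "z \<le> 2 ^ l" by (simp only: of_int_less_iff)
  define Q where "Q t = (\<Sum>i<nat (2 ^ l - z). drift (t + real i))" for t
  have "continuous_on UNIV Q"
    unfolding Q_def by (intro continuous_intros continuous_on_compose2[OF continuous_drift]) auto
  then have "isCont Q t1" by (simp add: continuous_on_eq_continuous_at)
  then obtain \<rho>1 where \<rho>1: "\<rho>1 > 0" "\<And>x. \<bar>x - t1\<bar> < \<rho>1 \<Longrightarrow> \<bar>Q x - Q t1\<bar> < 1/4"
    unfolding continuous_at_eps_delta dist_real_def by (metis zero_less_divide_1_iff zero_less_numeral)
  define \<rho>2 where "\<rho>2 = Min {\<rho>1, t1 - t, t + \<rho> - t1, z + 1 - t1}"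
  have \<rho>2: "\<rho>2 > 0" "\<rho>2 \<le> \<rho>1" "\<rho>2 \<le> t1 - t" "\<rho>2 \<le> t + \<rho> - t1" "\<rho>2 \<le> z + 1 - t1"
    using \<rho>1 t1 by (auto simp: \<rho>2_def)
  obtain P where P: "\<And>k::int. \<exists>t. \<bar>t - t1\<bar> < \<rho>2 \<and> (\<exists>J\<ge>l. (\<forall>j\<ge>J. sin (2 * pi * 5 ^ j * t) = 0) \<and>
       \<bar>(\<Sum>j=l..<J. sin (2 * pi * 5 ^ j * t)) - P - k\<bar> \<le> 3/4)"
    using sin_sums_hit[OF \<rho>2(1)] by blast
  show ?thesis
  proof (rule that[of "P + Q t1"])
    fix k :: int
    obtain t' J where t': "\<bar>t' - t1\<bar> < \<rho>2" "J \<ge> l" "\<And>j. j \<ge> J \<Longrightarrow> sin (2 * pi * 5 ^ j * t') = 0"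
       "\<bar>(\<Sum>j=l..<J. sin (2 * pi * 5 ^ j * t')) - P - k\<bar> \<le> 3/4"
      using P[of k] by blast
    have z: "of_int z \<le> t'" "t' < of_int z + 1"
      using t'(1) \<rho>2 t1 of_int_floor_le[of t] unfolding z_def by linarith+
    define s where "s = (\<Sum>i<nat (2 ^ J - z). drift (t' + real i))"
    \<comment> \<open>From block \<open>J\<close> on every drift is a multiple of a vanishing sine,
      so the partial sums are eventually constant.\<close>
    have zero: "drift (t' + real i) = 0" if "i \<ge> nat (2 ^ J - z)" for i
    proof -
      have *: "2 ^ J \<le> z + int i" using that by linarith
      then obtain j where j: "2 ^ j \<le> z + int i" "z + int i < 2 ^ (j + 1)" "J \<le> j"
      proof -
        have "real_of_int (2 ^ J) \<le> real_of_int (z + int i)" using * by (simp only: of_int_le_iff)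
        then have J: "2 ^ J \<le> \<bar>real_of_int (z + int i)\<bar>" by simp
        define j where "j = level (real_of_int (z + int i))"
        have "level (2 ^ J) = J" by (rule level_eq) auto
        then have "J \<le> j" using level_mono[of "2 ^ J" "real_of_int (z + int i)"] J by (simp add: j_def)
        have pos: "0 < z + int i" using * by (rule less_le_trans[rotated]) simp
        have "real_of_int (z + int i) < real_of_int (2 ^ (j + 1))"
          using less_two_power_level[of "real_of_int (z + int i)"] pos by (simp add: j_def)
        then have "z + int i < 2 ^ (j + 1)" by (simp only: of_int_less_iff)
        moreover have "2 ^ j \<le> z + int i"
        proof (cases "j = 0")
          case False
          then have "real_of_int (2 ^ j) \<le> real_of_int (z + int i)"
            using two_power_level_le[of "real_of_int (z + int i)"] pos by (simp add: j_def)
          then show ?thesis by (simp only: of_int_le_iff)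
        qed (use pos in simp)
        ultimately show ?thesis using that \<open>J \<le> j\<close> by blast
      qed
      then have "drift (t' + real i) = wave j t'" using z by (intro drift_translate)
      then show ?thesis using t'(3)[OF j(3)] by (simp add: wave_def)
    qed
    have "(\<Sum>i<n. drift (t' + real i)) = s" if "n \<ge> nat (2 ^ J - z)" for n
      unfolding s_def by (rule sum.mono_neutral_right) (use that zero in auto)
    then have "\<forall>\<^sub>F n in sequentially. (\<Sum>i<n. drift (t' + real i)) = s"
      by (auto simp: eventually_sequentially)
    moreover have "s = Q t' + (\<Sum>j=l..<J. sin (2 * pi * 5 ^ j * t'))"
      unfolding s_def Q_def by (rule sum_drift_blocks) (use z l t' in auto)
    moreover have "\<bar>Q t' - Q t1\<bar> < 1/4" using t'(1) \<rho>2 by (intro \<rho>1) auto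
    moreover have "\<bar>t' - t\<bar> < \<rho>" using t'(1) \<rho>2 by linarith
    ultimately have "\<bar>t' - t\<bar> < \<rho> \<and> \<bar>s - (P + Q t1) - k\<bar> \<le> 1 \<and>
       (\<forall>\<^sub>F n in sequentially. (\<Sum>i<n. drift (t' + real i)) = s)"
      using t'(4) by linarith
    then show "\<exists>t' s. \<bar>t' - t\<bar> < \<rho> \<and> \<bar>s - (P + Q t1) - k\<bar> \<le> 1 \<and>
       (\<forall>\<^sub>F n in sequentially. (\<Sum>i<n. drift (t' + real i)) = s)" by blast
  qed
qed

section \<open>The homeomorphism\<close>

text \<open>This is the addition formula of \<open>tanh\<close> as a fractional linear map; unlike
  \<open>tanh (artanh y + t)\<close> it makes direct sense at \<open>y = 1\<close> and
  \<open>y = -1\<close>.\<close>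

definition moebius :: "real \<Rightarrow> real \<Rightarrow> real" where
  "moebius a y = (y + a) / (1 + a * y)"

lemma moebius_denominator_pos:
  fixes a y :: real
  assumes "\<bar>a\<bar> < 1" "\<bar>y\<bar> \<le> 1"
  shows "0 < 1 + a * y"
proof -
  have "\<bar>a * y\<bar> \<le> \<bar>a\<bar> * 1" unfolding abs_mult by (intro mult_left_mono assms) simp
  then show ?thesis using assms(1) by linarith
qed

lemma moebius_tanh: "moebius (tanh a) (tanh y) = tanh (y + a)"
  by (subst tanh_add) (auto simp: moebius_def mult.commute)

lemma abs_moebius_le:
  assumes "\<bar>a\<bar> < 1" "\<bar>y\<bar> \<le> 1"
  shows "\<bar>moebius a y\<bar> \<le> 1"
proof -
  \<comment> \<open>The products expand to \<open>1 + a * y - (y + a)\<close> and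
    \<open>1 + a * y + (y + a)\<close>.\<close>
  have "0 \<le> (1 - y) * (1 - a)" "0 \<le> (1 + y) * (1 + a)"
    using assms by (auto intro!: mult_nonneg_nonneg)
  then have "\<bar>y + a\<bar> \<le> 1 + a * y" by (simp add: algebra_simps abs_le_iff)
  then show ?thesis
    using moebius_denominator_pos[OF assms] by (simp add: moebius_def abs_divide)
qed

lemma moebius_inverse:
  assumes "\<bar>a\<bar> < 1" "\<bar>y\<bar> \<le> 1"
  shows "moebius (- a) (moebius a y) = y"
proof -
  have p: "0 < 1 + a * y" using moebius_denominator_pos[OF assms] .
  have "a\<^sup>2 < 1" using assms(1) by (simp add: abs_square_less_1)
  then have a: "1 - a * a \<noteq> 0" by (simp add: power2_eq_square)
  have "moebius (- a) (moebius a y)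
      = ((y + a) - a * (1 + a * y)) / ((1 + a * y) - a * (y + a))"
    using p by (simp add: moebius_def divide_simps)
  also have "\<dots> = (y * (1 - a * a)) / (1 - a * a)" by (simp add: algebra_simps)
  finally show ?thesis using a by simp
qed

lemma moebius_minus: "moebius a (- y) = - moebius (- a) y"
proof -
  have "a - y = - (y - a)" by simp
  then show ?thesis unfolding moebius_def by (metis (no_types) add.commute minus_divide_left
    minus_mult_commute uminus_add_conv_diff)
qed

text \<open>The drift is read at the midpoint \<open>t + 1/2\<close> of the step from
  \<open>t\<close> to \<open>t + 1\<close>, so that reversing the step only changes the sign of this
  argument. The value 0 at the edges is the limit of the decaying drift.\<close>

definition speed :: "real \<Rightarrow> real" where
  "speed x = (if \<bar>x\<bar> < 1 then tanh (drift (artanh x + 1/2)) else 0)"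

text \<open>The Moebius transformations are translations in the coordinate \<open>artanh\<close> and extend them to
  the boundary of the square.\<close>

definition glide :: "real \<times> real \<Rightarrow> real \<times> real" where
  "glide p = (moebius (tanh 1) (fst p), moebius (speed (fst p)) (snd p))"

definition chart :: "real \<times> real \<Rightarrow> real \<times> real" where
  "chart p = (tanh (fst p), tanh (snd p))"

lemma speed_tanh: "speed (tanh t) = tanh (drift (t + 1/2))"
  using abs_tanh_less_1[of t] by (simp add: speed_def artanh_tanh_real)

lemma abs_speed_less_1: "\<bar>speed x\<bar> < 1"
  using abs_tanh_less_1 by (simp add: speed_def)

lemma abs_speed_le:
  assumes T: "1/2 < T" and x: "tanh T \<le> \<bar>x\<bar>"
  shows "\<bar>speed x\<bar> \<le> 2 / (T - 1/2)"
proof (cases "\<bar>x\<bar> < 1")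
  case True
  define t where "t = artanh x"
  have "x = tanh t" using True by (simp add: t_def tanh_artanh)
  then have "tanh T \<le> tanh \<bar>t\<bar>" using x by simp
  then have "T \<le> \<bar>t\<bar>" by (simp only: tanh_real_le_iff)
  then have "T - 1/2 \<le> \<bar>t + 1/2\<bar>" by linarith
  then have "\<bar>drift (t + 1/2)\<bar> \<le> 2 / (T - 1/2)" using T by (intro abs_drift_le) auto
  then show ?thesis
    using abs_tanh_le[of "drift (t + 1/2)"] by (simp add: \<open>x = tanh t\<close> speed_tanh)
qed (use T in \<open>simp add: speed_def\<close>)

lemma continuous_on_speed: "continuous_on {-1..1} speed"
  unfolding continuous_on_eq_continuous_within
proof
  fix x :: real assume "x \<in> {-1..1}"
  then consider "\<bar>x\<bar> < 1" | "\<bar>x\<bar> = 1" by fastforce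
  then have "isCont speed x"
  proof cases
    case 1
    have "isCont drift z" for z
      using continuous_drift by (simp add: continuous_on_eq_continuous_at)
    then have "isCont (\<lambda>x. drift (artanh x + 1/2)) x"
      using 1 by (intro isCont_o2[of x "\<lambda>x. artanh x + 1/2" drift] continuous_intros) auto
    then have "isCont (\<lambda>x. tanh (drift (artanh x + 1/2))) x"
      by (intro continuous_intros) auto
    moreover have "eventually (\<lambda>y. y \<in> {-1<..<1}) (nhds x)"
      using 1 by (intro eventually_nhds_in_open) auto
    then have "eventually (\<lambda>y. speed y = tanh (drift (artanh y + 1/2))) (nhds x)"
      by eventually_elim (auto simp: speed_def)
    ultimately show ?thesis using isCont_cong by metis
  next
    case 2
    then have speed: "speed x = 0" by (simp add: speed_def)
    have "(speed \<longlongrightarrow> 0) (at x)"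
    proof (rule tendstoI)
      fix e :: real assume "0 < e"
      define T where "T = 2 / e + 1"
      have T: "1/2 < T" "2 / (T - 1/2) < e" using \<open>0 < e\<close> by (auto simp: T_def field_simps)
      have "isCont abs x" by (intro continuous_intros)
      then have "(abs \<longlongrightarrow> 1) (at x)" using 2 by (simp add: isCont_def)
      then have "eventually (\<lambda>y. tanh T < \<bar>y\<bar>) (at x)"
        using tanh_real_lt_1 by (rule order_tendstoD(1))
      then show "eventually (\<lambda>y. dist (speed y) 0 < e) (at x)"
      proof eventually_elim
        case (elim y)
        then have "\<bar>speed y\<bar> \<le> 2 / (T - 1/2)" using T(1) by (intro abs_speed_le) auto
        then show ?case using T(2) by simp
      qed
    qed
    then show ?thesis by (simp add: isCont_def speed)
  qed
  then show "continuous (at x within {-1..1}) speed" by (rule continuous_at_imp_continuous_at_within)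
qed

lemma mem_square: "p \<in> square \<longleftrightarrow> \<bar>fst p\<bar> \<le> 1 \<and> \<bar>snd p\<bar> \<le> 1"
  by (cases p) (auto simp: square_def)

lemma uminus_mem_square: "- p \<in> square \<longleftrightarrow> p \<in> square"
  by (simp add: mem_square)

lemma glide_mem_square: "p \<in> square \<Longrightarrow> glide p \<in> square"
  using abs_moebius_le[OF abs_tanh_less_1[of 1]] abs_moebius_le[OF abs_speed_less_1]
  by (simp add: mem_square glide_def)

lemma continuous_on_glide: "continuous_on square glide"
proof -
  have nz: "1 + a * y \<noteq> 0" if "\<bar>a\<bar> < 1" "\<bar>y\<bar> \<le> 1" for a y :: real
    using moebius_denominator_pos[OF that] by simp
  have "continuous_on square (\<lambda>p. speed (fst p))"
    by (rule continuous_on_compose2[OF continuous_on_speed])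
      (auto simp: mem_square abs_le_iff intro!: continuous_intros)
  then show ?thesis
    unfolding glide_def moebius_def
    by (intro continuous_intros ballI nz abs_speed_less_1 abs_tanh_less_1)
      (auto simp: mem_square)
qed

text \<open>With \<open>x = tanh t\<close> the reflected image is \<open>tanh (- (t + 1))\<close>,
  whose midpoint is \<open>- (t + 1/2)\<close>; evenness of the drift does the rest.\<close>

lemma speed_minus_moebius:
  assumes "\<bar>x\<bar> \<le> 1"
  shows "speed (- moebius (tanh 1) x) = speed x"
proof (cases "\<bar>x\<bar> < 1")
  case True
  define t where "t = artanh x"
  have x: "x = tanh t" using True by (simp add: t_def tanh_artanh)
  have "- moebius (tanh 1) x = tanh (- (t + 1))" by (simp only: x moebius_tanh tanh_minus)
  then have "speed (- moebius (tanh 1) x) = tanh (drift (- (t + 1) + 1/2))"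
    by (simp only: speed_tanh)
  also have "- (t + 1) + 1/2 = - (t + 1/2)" by simp
  finally show ?thesis by (simp only: drift_minus x speed_tanh)
next
  case False
  then have "x = 1 \<or> x = -1" using assms by linarith
  moreover have "moebius (tanh 1) 1 = 1" "moebius (tanh 1) (-1) = -1"
    using tanh_real_bounds[of 1] by (simp_all add: moebius_def divide_eq_eq)
  ultimately have "\<bar>moebius (tanh 1) x\<bar> = 1" by auto
  then show ?thesis using False by (simp add: speed_def)
qed

text \<open>The reflection turns the second application into the inverse Moebius maps. Thus
  \<open>- glide\<close> is an involution of the square, and
  \<open>p \<mapsto> - glide (- p)\<close> is the inverse of \<open>glide\<close>.\<close>

lemma glide_reversible:
  assumes "p \<in> square"
  shows "- glide (- glide p) = p"
proof -
  obtain x y where p: "p = (x, y)" by (cases p)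
  have xy: "\<bar>x\<bar> \<le> 1" "\<bar>y\<bar> \<le> 1" using assms by (auto simp: p mem_square)
  have "- glide (- glide p) = (moebius (- tanh 1) (moebius (tanh 1) x),
      moebius (- speed x) (moebius (speed x) y))"
    by (simp add: p glide_def moebius_minus speed_minus_moebius xy)
  also have "\<dots> = p"
    using xy by (simp only: moebius_inverse abs_speed_less_1 abs_tanh_less_1 p)
  finally show ?thesis .
qed

lemma homeomorphism_glide: "homeomorphism square square glide (\<lambda>p. - glide (- p))"
proof (rule homeomorphismI)
  show "continuous_on square (\<lambda>p. - glide (- p))"
    by (intro continuous_intros continuous_on_compose2[OF continuous_on_glide])
      (use uminus_mem_square in blast)
  show "glide (- glide (- p)) = p" if "p \<in> square" for p
    using glide_reversible[of "- p"] that by (simp add: uminus_mem_square minus_equation_iff)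
  show "(\<lambda>p. - glide (- p)) ` square \<subseteq> square"
    using glide_mem_square uminus_mem_square by blast
qed (auto simp: glide_reversible glide_mem_square continuous_on_glide)

lemma glide_chart: "glide (chart (t, u)) = chart (t + 1, u + drift (t + 1/2))"
  by (simp add: glide_def chart_def speed_tanh moebius_tanh)

definition displacement :: "nat \<Rightarrow> real \<Rightarrow> real" where
  "displacement n t = (\<Sum>i<n. drift (t + 1/2 + real i))"

lemma glide_funpow_chart:
  "(glide ^^ n) (chart (t, u)) = chart (t + real n, u + displacement n t)"
  by (induction n) (simp_all add: displacement_def glide_chart algebra_simps)

text \<open>The chart covers the open square. Density lets sensitivity and entropy be handled in the
  coordinates \<open>(t, u)\<close>, without computing orbits on the boundary.\<close>

lemma square_subset_closure_range_chart: "square \<subseteq> closure (range chart)"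
proof -
  have "{-1<..<1} \<times> {-1<..<1} \<subseteq> range chart"
  proof
    fix p :: "real \<times> real" assume p: "p \<in> {-1<..<1} \<times> {-1<..<1}"
    have "p = chart (artanh (fst p), artanh (snd p))"
      using p by (cases p) (auto simp: chart_def tanh_artanh)
    then show "p \<in> range chart" by blast
  qed
  then have "closure ({-1<..<1} \<times> {-1<..<1}) \<subseteq> closure (range chart)" by (rule closure_mono)
  then show ?thesis by (simp add: square_def closure_Times)
qed

lemma chart_mem_square: "chart p \<in> square"
  using abs_tanh_less_1 by (simp add: mem_square chart_def less_imp_le)

section \<open>Limit sets\<close>

lemma omega_limit_convergent:
  assumes "(\<lambda>n. (f ^^ n) x) \<longlonglongrightarrow> L"
  shows "omega_limit f x = {L}"
proof -
  have "(\<lambda>i. (f ^^ r i) x) \<longlonglongrightarrow> L" if "strict_mono r" for r :: "nat \<Rightarrow> nat"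
    using LIMSEQ_subseq_LIMSEQ[OF assms that] by (simp add: o_def)
  \<comment> \<open>The times in \<open>omega_limit\<close> must be positive, so \<open>Suc\<close>
    and not the identity is the witness.\<close>
  moreover have "strict_mono Suc" by (simp add: strict_mono_Suc_iff)
  ultimately show ?thesis
    unfolding omega_limit_def by (auto intro: LIMSEQ_unique intro!: exI[of _ Suc])
qed

lemma omega_limit_chart:
  assumes "\<forall>\<^sub>F n in sequentially. displacement n t = s"
  shows "omega_limit glide (chart (t, u)) = {(1, tanh (u + s))}"
proof (rule omega_limit_convergent)
  have "filterlim (\<lambda>n. t + real n) at_top sequentially"
    by (intro filterlim_tendsto_add_at_top[OF tendsto_const] filterlim_real_sequentially)
  then have "(\<lambda>n. tanh (t + real n)) \<longlonglongrightarrow> 1"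
    by (rule filterlim_compose[OF tanh_real_at_top])
  moreover have "(\<lambda>n. tanh (u + displacement n t)) \<longlonglongrightarrow> tanh (u + s)"
    using assms by (intro tendsto_eventually) (auto elim: eventually_mono)
  ultimately show "(\<lambda>n. (glide ^^ n) (chart (t, u))) \<longlonglongrightarrow> (1, tanh (u + s))"
    unfolding glide_funpow_chart by (simp add: chart_def tendsto_Pair)
qed

text \<open>By the addition formula
  \<open>tanh v - tanh w = tanh (v - w) * (1 - tanh v * tanh w)\<close>. Unit gaps in a bounded
  range thus survive in the square with a uniform constant.\<close>

lemma tanh_diff_ge:
  fixes v w :: real
  assumes "\<bar>v\<bar> \<le> R" "\<bar>w\<bar> \<le> R" "1 \<le> \<bar>v - w\<bar>"
  shows "tanh 1 * (1 - (tanh R)\<^sup>2) \<le> \<bar>tanh v - tanh w\<bar>"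
proof -
  have "\<bar>tanh v\<bar> \<le> tanh R" "\<bar>tanh w\<bar> \<le> tanh R"
    using assms by (simp_all flip: tanh_real_abs)
  then have "\<bar>tanh v\<bar> * \<bar>tanh w\<bar> \<le> tanh R * tanh R"
    using assms(1) by (intro mult_mono) auto
  then have den: "1 - (tanh R)\<^sup>2 \<le> 1 - tanh v * tanh w"
    using abs_ge_self[of "tanh v * tanh w"] by (simp add: abs_mult power2_eq_square)
  have R1: "(tanh R)\<^sup>2 < 1" using abs_tanh_less_1[of R] by (simp add: abs_square_less_1)
  have "tanh (v - w) = (tanh v - tanh w) / (1 - tanh v * tanh w)"
    using tanh_add[of v "- w"] by simp
  then have eq: "tanh v - tanh w = tanh (v - w) * (1 - tanh v * tanh w)"
    using den R1 by simp
  have "tanh 1 \<le> tanh \<bar>v - w\<bar>" using assms(3) by (simp only: tanh_real_le_iff)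
  then have "tanh 1 * (1 - (tanh R)\<^sup>2) \<le> \<bar>tanh (v - w)\<bar> * (1 - tanh v * tanh w)"
    using den R1 by (intro mult_mono) auto
  then show ?thesis using den R1 by (simp add: eq abs_mult)
qed

lemma omega_n_sensitive_glide: "omega_n_sensitive square glide n"
proof -
  \<comment> \<open>The limit coordinates will be within \<open>3/2\<close> of \<open>4 * i\<close>
    for \<open>i < n\<close>, hence bounded by \<open>R\<close>. The constant \<open>s\<close> below
    depends on \<open>n\<close> alone; its factor \<open>1/2\<close> makes the final inequality
    strict.\<close>
  define R where "R = 4 * real n"
  define s where "s = tanh 1 * (1 - (tanh R)\<^sup>2) / 2"
  have "(tanh R)\<^sup>2 < 1" using abs_tanh_less_1[of R] by (simp add: abs_square_less_1)
  then have s: "0 < s" by (simp add: s_def)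
  show ?thesis
    unfolding omega_n_sensitive_def
  proof (intro exI[of _ s] conjI s ballI allI impI)
    fix x U assume x: "x \<in> square" and U: "openin (top_of_set square) U \<and> x \<in> U"
    obtain V where V: "open V" "U = square \<inter> V" using U by (auto simp: openin_open)
    have "x \<in> closure (range chart)" using x square_subset_closure_range_chart by blast
    then have "V \<inter> range chart \<noteq> {}"
      using U V open_Int_closure_eq_empty[of V "range chart"] by blast
    then obtain t u where tu: "chart (t, u) \<in> V" by auto
    have "continuous_on UNIV (\<lambda>t. chart (t, u))"
      unfolding chart_def by (intro continuous_intros) auto
    then have "open ((\<lambda>t. chart (t, u)) -` V)" using V(1) by (intro open_vimage)
    then obtain \<rho> where \<rho>: "0 < \<rho>" "\<And>t'. \<bar>t' - t\<bar> < \<rho> \<Longrightarrow> chart (t', u) \<in> V"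
      using tu by (auto simp: open_dist dist_real_def)
    obtain P where P: "\<And>k::int. \<exists>t' s. \<bar>t' - (t + 1/2)\<bar> < \<rho> \<and> \<bar>s - P - k\<bar> \<le> 1 \<and>
       (\<forall>\<^sub>F n in sequentially. (\<Sum>i<n. drift (t' + real i)) = s)"
      using displacements_hit[OF \<rho>(1)] by blast
    have "\<exists>y v. y \<in> U \<and> \<bar>v - 4 * real i\<bar> \<le> 3/2 \<and> omega_limit glide y = {(1, tanh v)}" for i
    proof -
      \<comment> \<open>The shift \<open>u + P\<close> depends on the neighbourhood. Subtracting its
        rounding leaves an error of \<open>1/2 + 1\<close>, so targets spaced by 4 remain at least 1
        apart, uniformly in the neighbourhood.\<close>
      define k where "k = 4 * int i - round (u + P)"
      obtain t' v where t': "\<bar>t' - (t + 1/2)\<bar> < \<rho>" "\<bar>v - P - k\<bar> \<le> 1"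
        "\<forall>\<^sub>F n in sequentially. (\<Sum>i<n. drift (t' + real i)) = v"
        using P[of k] by blast
      have "\<bar>of_int (round (u + P)) - (u + P)\<bar> \<le> 1/2" by (rule of_int_round_abs_le)
      moreover have "real_of_int k = 4 * real i - of_int (round (u + P))" by (simp add: k_def)
      ultimately have "\<bar>u + v - 4 * real i\<bar> \<le> 3/2" using t'(2) by linarith
      moreover have "\<forall>\<^sub>F n in sequentially. displacement n (t' - 1/2) = v"
        using t'(3) by (simp add: displacement_def)
      then have "omega_limit glide (chart (t' - 1/2, u)) = {(1, tanh (u + v))}"
        by (rule omega_limit_chart)
      moreover have "chart (t' - 1/2, u) \<in> V" using t'(1) by (intro \<rho>(2)) (simp add: algebra_simps)
      ultimately show ?thesis using chart_mem_square V(2) by blast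
    qed
    then obtain y v where y: "\<And>i. y i \<in> U" "\<And>i. \<bar>v i - 4 * real i\<bar> \<le> 3/2"
      "\<And>i. omega_limit glide (y i) = {(1, tanh (v i))}" by metis
    have "setdist (omega_limit glide (y i)) (omega_limit glide (y j)) > s"
      if ij: "i < n" "j < n" "i \<noteq> j" for i j
    proof -
      have "\<bar>v i\<bar> \<le> R" "\<bar>v j\<bar> \<le> R" "1 \<le> \<bar>v i - v j\<bar>"
        using y(2)[of i] y(2)[of j] ij unfolding R_def by linarith+
      then have "2 * s \<le> \<bar>tanh (v i) - tanh (v j)\<bar>"
        using tanh_diff_ge[of "v i" R "v j"] by (simp add: s_def)
      also have "\<dots> = setdist (omega_limit glide (y i)) (omega_limit glide (y j))"
        by (simp add: y(3) dist_Pair_Pair dist_real_def)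
      finally show ?thesis using s by linarith
    qed
    then show "\<exists>y. (\<forall>i<n. y i \<in> U) \<and> (\<forall>i<n. \<forall>j<n. i \<noteq> j \<longrightarrow>
        setdist (omega_limit glide (y i)) (omega_limit glide (y j)) > s)"
      using y(1) by (intro exI[of _ y]) blast
  qed
qed

section \<open>Transfer of sensitivity to the inverse\<close>

lemma setdist_uminus:
  fixes A B :: "'a::real_normed_vector set"
  shows "setdist (uminus ` A) (uminus ` B) = setdist A B"
proof -
  have "{dist x y |x y. x \<in> uminus ` A \<and> y \<in> uminus ` B} = {dist x y |x y. x \<in> A \<and> y \<in> B}"
  proof (intro Collect_cong iffI; clarify)
    fix x y assume "x \<in> A" "y \<in> B"
    then show "\<exists>x' y'. dist (- x) (- y) = dist x' y' \<and> x' \<in> A \<and> y' \<in> B"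
      by (intro exI[of _ x] exI[of _ y]) (simp add: dist_minus)
    show "\<exists>x' y'. dist x y = dist x' y' \<and> x' \<in> uminus ` A \<and> y' \<in> uminus ` B"
      using \<open>x \<in> A\<close> \<open>y \<in> B\<close> dist_minus[of x y] by (metis imageI)
  qed
  then show ?thesis by (simp add: setdist_def)
qed

lemma funpow_conjugate_uminus:
  fixes f :: "'a::group_add \<Rightarrow> 'a"
  shows "((\<lambda>p. - f (- p)) ^^ n) x = - (f ^^ n) (- x)"
  by (induction n) simp_all

lemma omega_limit_conjugate_uminus:
  fixes x :: "'a::real_normed_vector"
  shows "omega_limit (\<lambda>p. - f (- p)) x = uminus ` omega_limit f (- x)"
proof -
  have *: "y \<in> omega_limit (\<lambda>p. - f (- p)) x \<longleftrightarrow> - y \<in> omega_limit f (- x)" for y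
    unfolding omega_limit_def funpow_conjugate_uminus mem_Collect_eq
    by (simp only: tendsto_minus_cancel_left)
  show ?thesis
  proof (intro set_eqI iffI)
    fix y assume "y \<in> omega_limit (\<lambda>p. - f (- p)) x"
    then show "y \<in> uminus ` omega_limit f (- x)"
      unfolding * by (rule rev_image_eqI) simp
  next
    fix y assume "y \<in> uminus ` omega_limit f (- x)"
    then show "y \<in> omega_limit (\<lambda>p. - f (- p)) x"
      unfolding * by (elim imageE) (simp only: minus_minus)
  qed
qed

text \<open>The reflection is an isometry preserving \<open>X\<close>; it carries neighbourhoods and
  limit sets of \<open>f\<close> to those of the conjugate map, so the same \<open>s\<close>
  works.\<close>

lemma omega_n_sensitive_conjugate_uminus:
  fixes X :: "'a::real_normed_vector set"
  assumes "omega_n_sensitive X f n" and X: "\<And>x. - x \<in> X \<longleftrightarrow> x \<in> X"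
  shows "omega_n_sensitive X (\<lambda>p. - f (- p)) n"
proof -
  obtain s where s: "0 < s" "\<forall>x\<in>X. \<forall>U. openin (top_of_set X) U \<and> x \<in> U \<longrightarrow>
    (\<exists>y. (\<forall>i<n. y i \<in> U) \<and> (\<forall>i<n. \<forall>j<n. i \<noteq> j \<longrightarrow>
      setdist (omega_limit f (y i)) (omega_limit f (y j)) > s))"
    using assms(1) unfolding omega_n_sensitive_def by (elim exE conjE)
  show ?thesis
    unfolding omega_n_sensitive_def
  proof (intro exI[of _ s] conjI s(1) ballI allI impI)
    fix x U assume x: "x \<in> X" and U: "openin (top_of_set X) U \<and> x \<in> U"
    obtain V where V: "open V" "U = X \<inter> V" using U by (auto simp: openin_open)
    have V': "openin (top_of_set X) (X \<inter> uminus ` V)"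
      using V by (intro openin_open_Int open_negations)
    have x': "- x \<in> X" "- x \<in> X \<inter> uminus ` V" using x U V X by simp_all
    obtain y where y: "\<forall>i<n. y i \<in> X \<inter> uminus ` V" "\<forall>i<n. \<forall>j<n. i \<noteq> j \<longrightarrow>
        setdist (omega_limit f (y i)) (omega_limit f (y j)) > s"
      using s(2)[THEN bspec, OF x'(1), THEN spec, THEN mp, OF conjI[OF V' x'(2)]] by (elim exE conjE)
    have "- y i \<in> U" if "i < n" for i
      using y(1) that V(2) X[of "y i"] by force
    then show "\<exists>y. (\<forall>i<n. y i \<in> U) \<and> (\<forall>i<n. \<forall>j<n. i \<noteq> j \<longrightarrow>
      setdist (omega_limit (\<lambda>p. - f (- p)) (y i)) (omega_limit (\<lambda>p. - f (- p)) (y j)) > s)"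
      using y(2) by (intro exI[of _ "\<lambda>i. - y i"])
        (simp add: omega_limit_conjugate_uminus setdist_uminus)
  qed
qed

section \<open>Entropy\<close>

text \<open>Codes need only be given on a dense subset: the closures of the finitely many code
  classes cover \<open>X\<close>, and the non-strict bound \<epsilon> passes to them by continuity.
  A separated set then has at most one point per code.\<close>

lemma sep_num_le_card_codes:
  fixes f :: "'a::metric_space \<Rightarrow> 'a" and G :: "'b \<Rightarrow> 'a" and code :: "'b \<Rightarrow> 'c"
  assumes X: "X \<subseteq> closure (range G)" "range G \<subseteq> X" "f ` X \<subseteq> X" "continuous_on X f"
    and A: "finite A" "range code \<subseteq> A" and n: "0 < n"
    and close: "\<And>p q k. code p = code q \<Longrightarrow> k < n \<Longrightarrow> dist ((f ^^ k) (G p)) ((f ^^ k) (G q)) \<le> \<epsilon>"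
  shows "sep_num X f n \<epsilon> \<le> card A"
proof -
  define B where "B a = G ` {p. code p = a}" for a
  have inX: "(f ^^ k) ` X \<subseteq> X" for k
    using X(3) by (induction k) auto
  have cont: "continuous_on X (f ^^ k)" for k
  proof (induction k)
    case (Suc k)
    then show ?case
      using continuous_on_compose[OF Suc continuous_on_subset[OF X(4) inX[of k]]] by simp
  qed (simp add: id_def)
  have near: "dist ((f ^^ k) x) ((f ^^ k) y) \<le> \<epsilon>"
    if x: "x \<in> X" "x \<in> closure (B a)" and y: "y \<in> X" "y \<in> closure (B a)" and k: "k < n" for x y a k
  proof -
    obtain xs ys where s: "\<forall>i. xs i \<in> B a" "xs \<longlonglongrightarrow> x" "\<forall>i. ys i \<in> B a" "ys \<longlonglongrightarrow> y"
      using x(2) y(2) unfolding closure_sequential by blast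
    have BX: "B a \<subseteq> X" using X(2) by (auto simp: B_def)
    have "(\<lambda>i. (f ^^ k) (xs i)) \<longlonglongrightarrow> (f ^^ k) x" "(\<lambda>i. (f ^^ k) (ys i)) \<longlonglongrightarrow> (f ^^ k) y"
      using s BX x y by (auto intro!: continuous_on_tendsto_compose[OF cont] always_eventually)
    then have "(\<lambda>i. dist ((f ^^ k) (xs i)) ((f ^^ k) (ys i))) \<longlonglongrightarrow> dist ((f ^^ k) x) ((f ^^ k) y)"
      by (rule tendsto_dist)
    moreover have "dist ((f ^^ k) (xs i)) ((f ^^ k) (ys i)) \<le> \<epsilon>" for i
    proof -
      obtain p q where "xs i = G p" "ys i = G q" "code p = code q"
        using s(1)[THEN spec, of i] s(3)[THEN spec, of i] unfolding B_def by auto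
      then show ?thesis using close k by simp
    qed
    ultimately show ?thesis by (intro LIMSEQ_le_const2) auto
  qed
  have cover: "\<exists>a\<in>A. x \<in> closure (B a)" if "x \<in> X" for x
  proof -
    have "range G \<subseteq> (\<Union>a\<in>A. closure (B a))"
    proof clarify
      fix p
      have "G p \<in> B (code p)" by (simp add: B_def)
      then show "G p \<in> (\<Union>a\<in>A. closure (B a))" using A(2) closure_subset by blast
    qed
    then have "closure (range G) \<subseteq> (\<Union>a\<in>A. closure (B a))"
      using A(1) by (intro closure_minimal closed_UN) auto
    then show ?thesis using X(1) that by blast
  qed
  have "card E \<le> card A" if E: "separated_set X f n \<epsilon> E" for E
  proof -
    have EX: "E \<subseteq> X" using E by (simp add: separated_set_def)
    then obtain a where a: "\<And>x. x \<in> E \<Longrightarrow> a x \<in> A \<and> x \<in> closure (B (a x))"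
      using cover by (metis subsetD)
    have "inj_on a E"
    proof (rule inj_onI, rule ccontr)
      fix x y assume xy: "x \<in> E" "y \<in> E" "a x = a y" "x \<noteq> y"
      have "bowen_dist f n x y \<le> \<epsilon>"
        unfolding bowen_dist_def
      proof (rule Max.boundedI)
        show "{dist ((f ^^ k) x) ((f ^^ k) y) |k. k < n} \<noteq> {}" using n by auto
        fix d assume "d \<in> {dist ((f ^^ k) x) ((f ^^ k) y) |k. k < n}"
        then obtain k where "k < n" "d = dist ((f ^^ k) x) ((f ^^ k) y)" by blast
        then show "d \<le> \<epsilon>" using near[of x "a x" y k] a[OF xy(1)] a[OF xy(2)] xy EX by auto
      qed simp
      then show False using E xy by (force simp: separated_set_def)
    qed
    then show ?thesis using a A(1) by (intro card_inj_on_le[of a]) auto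
  qed
  moreover have "finite {} \<and> separated_set X f n \<epsilon> {}" by (simp add: separated_set_def)
  then have "{card E |E. finite E \<and> separated_set X f n \<epsilon> E} \<noteq> {}" by blast
  ultimately show ?thesis
    unfolding sep_num_def by (intro cSup_least) auto
qed

section \<open>Coding orbits by truncated coordinates\<close>

definition clamp_to :: "real \<Rightarrow> real \<Rightarrow> real" where
  "clamp_to R t = max (- R) (min R t)"

text \<open>Truncation keeps the number of codes finite. Nearby truncated values mean real proximity
  or a common far end, as \<open>h \<le> R\<close> excludes opposite ends.\<close>

lemma clamp_to_cases:
  assumes "\<bar>clamp_to R s - clamp_to R t\<bar> \<le> h" "h \<le> R" "0 < R"
  obtains "\<bar>s\<bar> \<le> R" "\<bar>t\<bar> \<le> R" "\<bar>s - t\<bar> \<le> h"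
    | "R - h \<le> s" "R - h \<le> t"
    | "s \<le> - (R - h)" "t \<le> - (R - h)"
  using assms unfolding clamp_to_def max_def min_def by (auto split: if_splits)

lemma abs_clamp_to_le: "0 \<le> R \<Longrightarrow> \<bar>clamp_to R t\<bar> \<le> R"
  by (auto simp: clamp_to_def)

lemma tanh_diff_far:
  fixes v w :: real
  assumes "R \<le> v" "R \<le> w"
  shows "\<bar>tanh v - tanh w\<bar> \<le> 1 - tanh R"
proof -
  have "tanh R \<le> tanh v" "tanh R \<le> tanh w" using assms by (simp_all only: tanh_real_le_iff)
  then show ?thesis using tanh_real_lt_1[of v] tanh_real_lt_1[of w] by linarith
qed

lemma tanh_diff_far_left:
  fixes v w :: real
  assumes "v \<le> - R" "w \<le> - R"
  shows "\<bar>tanh v - tanh w\<bar> \<le> 1 - tanh R"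
proof -
  have "R \<le> - v" "R \<le> - w" using assms by linarith+
  from tanh_diff_far[OF this] show ?thesis by (simp add: abs_minus_commute)
qed

lemma abs_displacement_le:
  assumes "\<And>i. i < k \<Longrightarrow> \<bar>drift (t + 1/2 + real i)\<bar> \<le> b"
  shows "\<bar>displacement k t\<bar> \<le> real k * b"
proof -
  have "\<bar>displacement k t\<bar> \<le> (\<Sum>i<k. \<bar>drift (t + 1/2 + real i)\<bar>)"
    unfolding displacement_def by (rule sum_abs)
  also have "\<dots> \<le> (\<Sum>i<k. b)" using assms by (intro sum_mono) auto
  finally show ?thesis by simp
qed

lemma displacement_lipschitz:
  assumes "\<bar>s\<bar> + real k + 1 \<le> R" "\<bar>t\<bar> + real k + 1 \<le> R"
  shows "\<bar>displacement k s - displacement k t\<bar> \<le> real k * (8 * (1 + R\<^sup>2) * \<bar>s - t\<bar>)"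
proof -
  have "\<bar>displacement k s - displacement k t\<bar>
      \<le> (\<Sum>i<k. \<bar>drift (s + 1/2 + real i) - drift (t + 1/2 + real i)\<bar>)"
    unfolding displacement_def sum_subtractf[symmetric] by (rule sum_abs)
  also have "\<dots> \<le> (\<Sum>i<k. 8 * (1 + R\<^sup>2) * \<bar>s - t\<bar>)"
  proof (rule sum_mono)
    fix i assume "i \<in> {..<k}"
    then have "real i + 1 \<le> real k" by simp
    then have "\<bar>s + 1/2 + real i\<bar> \<le> R" "\<bar>t + 1/2 + real i\<bar> \<le> R" using assms by linarith+
    then show "\<bar>drift (s + 1/2 + real i) - drift (t + 1/2 + real i)\<bar> \<le> 8 * (1 + R\<^sup>2) * \<bar>s - t\<bar>"
      using drift_lipschitz[of "s + 1/2 + real i" R "t + 1/2 + real i"] by simp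
  qed
  finally show ?thesis by simp
qed

text \<open>Far to the left or right the drift is so small that \<open>n\<close> steps do not accumulate anything;
  in the remaining range the displacement is Lipschitz with a polynomial constant.\<close>

lemma displacement_close:
  assumes n: "1 \<le> n" and k: "k < n"
    and st: "\<bar>clamp_to (5 * real n ^ 2) s - clamp_to (5 * real n ^ 2) t\<bar> \<le> 1 / real n ^ 6"
  shows "\<bar>displacement k s - displacement k t\<bar> \<le> 400 / real n"
    and "\<bar>tanh (s + real k) - tanh (t + real k)\<bar> \<le> max (1 / real n) (1 - tanh (real n))"
proof -
  define N where "N = real n"
  have N: "1 \<le> N" using n by (simp add: N_def)
  have k': "real k + 1 \<le> N" using k by (simp add: N_def)
  have N2: "N \<le> N\<^sup>2" "1 \<le> N\<^sup>2" using N by (auto simp: power2_eq_square intro: order_trans)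
  have N6: "1 / N ^ 6 \<le> 1 / N" using N self_le_power[of N 6] by (simp add: frac_le)
  have N1: "1 / N \<le> 1" using N by simp
  have h: "1 / N ^ 6 \<le> 1" "0 \<le> 1 / N ^ 6" using N6 N1 N by (linarith, simp)
  \<comment> \<open>Beyond \<open>2 * N\<^sup>2\<close> a step drifts by at most
    \<open>1 / N\<^sup>2\<close>, so fewer than \<open>N\<close> steps move each orbit by at most
    \<open>1 / N\<close>.\<close>
  have far: "\<bar>displacement k s - displacement k t\<bar> \<le> 400 / N"
    if b: "\<And>r i. r \<in> {s, t} \<Longrightarrow> i < k \<Longrightarrow> 2 * N\<^sup>2 \<le> \<bar>r + 1/2 + real i\<bar>"
  proof -
    have "\<bar>displacement k r\<bar> \<le> 1 / N" if r: "r \<in> {s, t}" for r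
    proof -
      have "\<bar>displacement k r\<bar> \<le> real k * (2 / (2 * N\<^sup>2))"
        using b[OF r] N by (intro abs_displacement_le abs_drift_le) auto
      also have "\<dots> \<le> N * (2 / (2 * N\<^sup>2))" using k' N by (intro mult_right_mono) auto
      also have "\<dots> = 1 / N" using N by (simp add: power2_eq_square)
      finally show ?thesis .
    qed
    from this[of s] this[of t] have "\<bar>displacement k s - displacement k t\<bar> \<le> 2 * (1 / N)" by simp
    also have "\<dots> \<le> 400 / N" using N by (simp add: divide_right_mono)
    finally show ?thesis .
  qed
  have R: "1 / N ^ 6 \<le> 5 * N\<^sup>2" "0 < 5 * N\<^sup>2" using h N2 by linarith+
  have "\<bar>displacement k s - displacement k t\<bar> \<le> 400 / N \<and>
      \<bar>tanh (s + real k) - tanh (t + real k)\<bar> \<le> max (1 / N) (1 - tanh N)"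
    using st[folded N_def] R
  proof (cases rule: clamp_to_cases)
    case 1
    have "\<bar>s\<bar> + real k + 1 \<le> 6 * N\<^sup>2" "\<bar>t\<bar> + real k + 1 \<le> 6 * N\<^sup>2"
      using 1 k' N2 by linarith+
    then have "\<bar>displacement k s - displacement k t\<bar> \<le> real k * (8 * (1 + (6 * N\<^sup>2)\<^sup>2) * \<bar>s - t\<bar>)"
      by (rule displacement_lipschitz)
    also have "\<dots> \<le> N * (8 * (1 + (6 * N\<^sup>2)\<^sup>2) * (1 / N ^ 6))"
      using 1 k' N by (intro mult_mono) auto
    \<comment> \<open>Bounding 1 by \<open>N ^ 4\<close> gives total growth
      \<open>8 * 37 * N ^ 5\<close>; the mesh \<open>1 / N ^ 6\<close> is chosen to beat it by a
      factor \<open>N\<close>.\<close>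
    also have "\<dots> \<le> N * (8 * (N ^ 4 + (6 * N\<^sup>2)\<^sup>2) * (1 / N ^ 6))"
      using N by (intro mult_left_mono mult_right_mono add_right_mono one_le_power) auto
    also have "\<dots> = 296 / N"
      using N by (simp add: power_mult_distrib divide_simps) (simp add: algebra_simps eval_nat_numeral)
    also have "\<dots> \<le> 400 / N" using N by (simp add: divide_right_mono)
    finally have "\<bar>displacement k s - displacement k t\<bar> \<le> 400 / N" .
    moreover have "\<bar>tanh (s + real k) - tanh (t + real k)\<bar> \<le> 1 / N"
      using tanh_lipschitz[of "s + real k" "t + real k"] 1(3) N6 by simp
    ultimately show ?thesis by auto
  next
    case 2
    have "2 * N\<^sup>2 \<le> s" "2 * N\<^sup>2 \<le> t" using 2 h N2 by linarith+
    then have "\<bar>displacement k s - displacement k t\<bar> \<le> 400 / N" by (intro far) auto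
    moreover have "\<bar>tanh (s + real k) - tanh (t + real k)\<bar> \<le> 1 - tanh N"
      using \<open>2 * N\<^sup>2 \<le> s\<close> \<open>2 * N\<^sup>2 \<le> t\<close> N2 by (intro tanh_diff_far) linarith+
    ultimately show ?thesis by auto
  next
    case 3
    \<comment> \<open>On the left the orbit moves towards the centre; the radius
      \<open>5 * N\<^sup>2\<close> leaves room for all steps to stay beyond
      \<open>2 * N\<^sup>2\<close>.\<close>
    have st: "s \<le> - (2 * N\<^sup>2) - N - 1" "t \<le> - (2 * N\<^sup>2) - N - 1" using 3 h N2 by linarith+
    have "\<bar>displacement k s - displacement k t\<bar> \<le> 400 / N"
    proof (rule far)
      fix r i assume "r \<in> {s, t}" "i < k"
      then have "r \<le> - (2 * N\<^sup>2) - N - 1" "real i \<le> real k" using st by auto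
      then show "2 * N\<^sup>2 \<le> \<bar>r + 1/2 + real i\<bar>" using k' by linarith
    qed
    moreover have "\<bar>tanh (s + real k) - tanh (t + real k)\<bar> \<le> 1 - tanh N"
      using st k' N2 by (intro tanh_diff_far_left) linarith+
    ultimately show ?thesis by auto
  qed
  then show "\<bar>displacement k s - displacement k t\<bar> \<le> 400 / real n"
    and "\<bar>tanh (s + real k) - tanh (t + real k)\<bar> \<le> max (1 / real n) (1 - tanh (real n))"
    by (simp_all add: N_def)
qed

text \<open>Each coordinate errs by at most \<open>e\<close>. For the second one, a drift of at most
  1 per step cannot bring a far point \<open>u\<close> back within \<open>N\<close>, while in the
  middle range the errors \<open>1 / N\<close> and \<open>400 / N\<close> add.\<close>

lemma glide_orbits_close:
  assumes n: "1 \<le> n" and k: "k < n"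
    and st: "\<bar>clamp_to (5 * real n ^ 2) s - clamp_to (5 * real n ^ 2) t\<bar> \<le> 1 / real n ^ 6"
    and uv: "\<bar>clamp_to (5 * real n ^ 2) u - clamp_to (5 * real n ^ 2) v\<bar> \<le> 1 / real n ^ 6"
    and e: "401 / real n \<le> e" "1 - tanh (real n) \<le> e"
  shows "dist ((glide ^^ k) (chart (s, u))) ((glide ^^ k) (chart (t, v))) \<le> 2 * e"
proof -
  define N where "N = real n"
  have N: "1 \<le> N" using n by (simp add: N_def)
  have k': "real k + 1 \<le> N" using k by (simp add: N_def)
  have N2: "N \<le> N\<^sup>2" "1 \<le> N\<^sup>2" using N by (auto simp: power2_eq_square intro: order_trans)
  have N6: "1 / N ^ 6 \<le> 1 / N" using N self_le_power[of N 6] by (simp add: frac_le)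
  have N1: "1 / N \<le> 1" using N by simp
  have h: "1 / N ^ 6 \<le> 1" "0 \<le> 1 / N ^ 6" using N6 N1 N by (linarith, simp)
  have R: "1 / N ^ 6 \<le> 5 * N\<^sup>2" "0 < 5 * N\<^sup>2" using h N2 by linarith+
  have sum: "1 / N + 400 / N = 401 / N" by (simp flip: add_divide_distrib)
  have le_e: "1 / N \<le> e" using e(1) N sum unfolding N_def[symmetric] by (smt (verit) divide_nonneg_nonneg)
  have fst: "\<bar>tanh (s + real k) - tanh (t + real k)\<bar> \<le> e"
    using displacement_close(2)[OF n k st] e(2) le_e by (simp add: N_def)
  have disp: "\<bar>displacement k s - displacement k t\<bar> \<le> 400 / N"
    using displacement_close(1)[OF n k st] by (simp add: N_def)
  have small: "\<bar>displacement k r\<bar> \<le> N" for r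
    using abs_displacement_le[of k r 1] abs_drift_le_1 k' by simp
  have snd: "\<bar>tanh (u + displacement k s) - tanh (v + displacement k t)\<bar> \<le> e"
    using uv[folded N_def] R
  proof (cases rule: clamp_to_cases)
    case 1
    have "\<bar>tanh (u + displacement k s) - tanh (v + displacement k t)\<bar>
        \<le> \<bar>(u + displacement k s) - (v + displacement k t)\<bar>" by (rule tanh_lipschitz)
    also have "\<dots> \<le> e" using disp 1(3) N6 sum e(1) unfolding N_def[symmetric] by linarith
    finally show ?thesis .
  next
    case 2
    then have "N \<le> u + displacement k s" "N \<le> v + displacement k t"
      using small[of s] small[of t] h N2 by linarith+
    from tanh_diff_far[OF this] show ?thesis using e(2) by (simp add: N_def)
  next
    case 3
    then have "u + displacement k s \<le> - N" "v + displacement k t \<le> - N"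
      using small[of s] small[of t] h N2 by linarith+
    from tanh_diff_far_left[OF this] show ?thesis using e(2) by (simp add: N_def)
  qed
  have "dist ((glide ^^ k) (chart (s, u))) ((glide ^^ k) (chart (t, v)))
      \<le> \<bar>tanh (s + real k) - tanh (t + real k)\<bar>
        + \<bar>tanh (u + displacement k s) - tanh (v + displacement k t)\<bar>"
    using sqrt_sum_squares_le_sum_abs[of "tanh (s + real k) - tanh (t + real k)"
        "tanh (u + displacement k s) - tanh (v + displacement k t)"]
    unfolding glide_funpow_chart by (simp add: chart_def dist_Pair_Pair dist_real_def)
  then show ?thesis using fst snd by linarith
qed

text \<open>Cutting a window of length \<open>10 * n ^ 2\<close> at mesh \<open>1 / n ^ 6\<close>
  leaves \<open>10 * n ^ 8 + 1\<close> possible digits per coordinate, a polynomial number of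
  codes.\<close>

lemma sep_num_glide_le:
  assumes n: "1 \<le> n" and e: "401 / real n \<le> e" "1 - tanh (real n) \<le> e"
  shows "sep_num square glide n (2 * e) \<le> (10 * n ^ 8 + 1) ^ 2"
proof -
  define digit where "digit t = \<lfloor>real n ^ 6 * clamp_to (5 * real n ^ 2) t\<rfloor>" for t
  define D where "D = {- (5 * int n ^ 8)..5 * int n ^ 8}"
  define code where "code p = (digit (fst p), digit (snd p))" for p
  have n0: "0 < real n" using n by simp
  have digit_close: "\<bar>clamp_to (5 * real n ^ 2) s - clamp_to (5 * real n ^ 2) t\<bar> \<le> 1 / real n ^ 6"
    if "digit s = digit t" for s t
  proof -
    have "\<bar>real n ^ 6 * clamp_to (5 * real n ^ 2) s - real n ^ 6 * clamp_to (5 * real n ^ 2) t\<bar> \<le> 1"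
      using that unfolding digit_def by linarith
    then have "real n ^ 6 * \<bar>clamp_to (5 * real n ^ 2) s - clamp_to (5 * real n ^ 2) t\<bar> \<le> 1"
      by (simp add: abs_mult flip: right_diff_distrib)
    then show ?thesis using n0 by (simp add: pos_le_divide_eq mult.commute)
  qed
  have digit_D: "digit t \<in> D" for t
  proof -
    have "\<bar>real n ^ 6 * clamp_to (5 * real n ^ 2) t\<bar> \<le> real n ^ 6 * (5 * real n ^ 2)"
      unfolding abs_mult using n0 by (intro mult_mono abs_clamp_to_le) auto
    also have "\<dots> = real_of_int (5 * int n ^ 8)" by (simp flip: power_add)
    finally have *: "\<bar>real n ^ 6 * clamp_to (5 * real n ^ 2) t\<bar> \<le> real_of_int (5 * int n ^ 8)" .
    have "- (5 * int n ^ 8) \<le> digit t" unfolding digit_def le_floor_iff using * by simp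
    moreover have "digit t \<le> 5 * int n ^ 8"
      unfolding digit_def using floor_mono[of _ "real_of_int (5 * int n ^ 8)"] *
      by (metis abs_le_D1 floor_of_int)
    ultimately show ?thesis by (simp add: D_def)
  qed
  have "sep_num square glide n (2 * e) \<le> card (D \<times> D)"
  proof (rule sep_num_le_card_codes[where G = chart and code = code])
    fix p q k assume "code p = code q" "k < n"
    then show "dist ((glide ^^ k) (chart p)) ((glide ^^ k) (chart q)) \<le> 2 * e"
      using glide_orbits_close[OF n, of k "fst p" "fst q" "snd p" "snd q" e] digit_close e
      by (simp add: code_def)
  next
    show "range code \<subseteq> D \<times> D" using digit_D by (auto simp: code_def)
  qed (use n square_subset_closure_range_chart chart_mem_square glide_mem_square
        continuous_on_glide in \<open>auto simp: D_def\<close>)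
  also have "card D = 10 * n ^ 8 + 1"
    by (simp add: D_def nat_add_distrib nat_mult_distrib nat_power_eq)
  then have "card (D \<times> D) = (10 * n ^ 8 + 1) ^ 2" by (simp add: power2_eq_square card_cartesian_product)
  finally show ?thesis .
qed

lemma top_entropy_glide: "top_entropy square glide = 0"
proof -
  have "limsup (\<lambda>n. ereal (ln (real (sep_num square glide n \<epsilon>)) / real n)) = 0" if "0 < \<epsilon>" for \<epsilon>
  proof (rule antisym)
    have "(\<lambda>n. 401 / real n) \<longlonglongrightarrow> 0" by (rule lim_const_over_n)
    then have ev1: "\<forall>\<^sub>F n in sequentially. 401 / real n < \<epsilon> / 2"
      using that by (intro order_tendstoD) auto
    have "(\<lambda>n. tanh (real n)) \<longlonglongrightarrow> 1"
      by (rule filterlim_compose[OF tanh_real_at_top filterlim_real_sequentially])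
    then have ev2: "\<forall>\<^sub>F n in sequentially. 1 - \<epsilon> / 2 < tanh (real n)"
      using that by (intro order_tendstoD) auto
    have "\<forall>\<^sub>F n in sequentially. ln (real (sep_num square glide n \<epsilon>)) / real n
        \<le> 2 * ln 11 / real n + 16 * (ln (real n) / real n)"
      using ev1 ev2 eventually_ge_at_top[of 1]
    proof eventually_elim
      case (elim n)
      have "sep_num square glide n \<epsilon> \<le> (10 * n ^ 8 + 1) ^ 2"
        using sep_num_glide_le[of n "\<epsilon> / 2"] elim by simp
      also have "\<dots> \<le> (11 * n ^ 8) ^ 2" using elim by (intro power_mono) auto
      finally have "real (sep_num square glide n \<epsilon>) \<le> real ((11 * n ^ 8) ^ 2)"
        by (simp only: of_nat_le_iff)
      then have le: "real (sep_num square glide n \<epsilon>) \<le> 11 ^ 2 * real n ^ 16"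
        by (simp add: power_mult_distrib)
      have "ln (11 ^ 2 * real n ^ 16) = ln (11 ^ 2) + ln (real n ^ 16)"
        using elim by (intro ln_mult_pos) auto
      also have "\<dots> = 2 * ln 11 + 16 * ln (real n)"
        using ln_realpow[of 11 2] ln_realpow[of "real n" 16] elim by simp
      finally have "ln (11 ^ 2 * real n ^ 16) = 2 * ln 11 + 16 * ln (real n)" .
      moreover have "ln (real (sep_num square glide n \<epsilon>)) \<le> ln (11 ^ 2 * real n ^ 16)"
      \<comment> \<open>The value 0 is split off because \<open>ln\<close> is monotone only on
        positive arguments; there the convention \<open>ln 0 = 0\<close> applies.\<close>
      proof (cases "sep_num square glide n \<epsilon> = 0")
        case True
        have "1 * 1 \<le> 11 ^ 2 * real n ^ 16" using elim by (intro mult_mono one_le_power) auto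
        then show ?thesis using True by simp
      next
        case False
        then show ?thesis using le by (intro ln_mono) auto
      qed
      ultimately have "ln (real (sep_num square glide n \<epsilon>)) / real n
          \<le> (2 * ln 11 + 16 * ln (real n)) / real n" by (intro divide_right_mono) auto
      then show ?case by (simp add: add_divide_distrib)
    qed
    then have "limsup (\<lambda>n. ereal (ln (real (sep_num square glide n \<epsilon>)) / real n))
        \<le> limsup (\<lambda>n. ereal (2 * ln 11 / real n + 16 * (ln (real n) / real n)))"
      by (intro Limsup_mono) (auto elim: eventually_mono)
    also have "(\<lambda>n. 2 * ln 11 / real n + 16 * (ln (real n) / real n)) \<longlonglongrightarrow> 0 + 16 * 0"
      by (intro tendsto_intros lim_const_over_n lim_ln_over_n)
    then have "limsup (\<lambda>n. ereal (2 * ln 11 / real n + 16 * (ln (real n) / real n))) = 0"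
      by (intro lim_imp_Limsup) (auto simp: zero_ereal_def)
    finally show "limsup (\<lambda>n. ereal (ln (real (sep_num square glide n \<epsilon>)) / real n)) \<le> 0" .
    have "0 \<le> ln (real m)" for m by (cases m) auto
    then show "0 \<le> limsup (\<lambda>n. ereal (ln (real (sep_num square glide n \<epsilon>)) / real n))"
      by (intro le_Limsup always_eventually allI) auto
  qed
  then show ?thesis by (simp add: top_entropy_def)
qed

theorem theorem1p3:
  shows "\<exists>f g. homeomorphism square square f g \<and> top_entropy square f = 0 \<and>
    (\<forall>n::nat. n \<ge> 2 \<longrightarrow> omega_n_sensitive square f n \<and> alpha_n_sensitive square f g n)"
proof (intro exI conjI allI impI)
  show "homeomorphism square square glide (\<lambda>p. - glide (- p))" by (rule homeomorphism_glide)
  show "top_entropy square glide = 0" by (rule top_entropy_glide)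
  show "omega_n_sensitive square glide n" for n by (rule omega_n_sensitive_glide)
  then show "alpha_n_sensitive square glide (\<lambda>p. - glide (- p)) n" for n
    unfolding alpha_n_sensitive_def
    by (rule omega_n_sensitive_conjugate_uminus) (rule uminus_mem_square)
qed

end
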